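(* Let $C$ be a category and let $\Delta$ be a family of endofunctors of $C$ with each endofunctor in $\Delta$ being frank and fulfilling (P). (i) For each $a,b\in\mathrm{ob}(C)$, $$\mathrm{rd}(a,b)\le\min\{\,|\overline{\delta}(\hom(a,b))|\;\mid\;\overline{\delta}\in\langle\Delta\rangle\}.$$ (ii) For each $a\in\mathrm{ob}(C)$, $$\mathrm{rd}(a)\le\sup_{b\in\mathrm{ob}(C)}\min\{\,|\overline{\delta}(\hom(a,b))|\;\mid\;\overline{\delta}\in\langle\Delta\rangle\}.$$
   Context: For a category $C$, $\mathrm{ob}(C)$ is the class of objects and $\hom(a,b)$ is the class of morphisms of $C$ from $a$ to $b$; composition is written $g\cdot f$ (for $f\in\hom(a,b)$, $g\in\hom(b,c)$, $g\cdot f\in\hom(a,c)$). $\mathbb N$ includes $0$. For $r\in\mathbb N$, an $r$-coloring of a set $X$ is a function on $X$ with at most $r$ values. For a functor $\delta$ on $C$, $\delta(\hom(a,b))=\{\delta(f)\mid f\in\hom(a,b)\}$; $|x|$ denotes cardinality, and an infinite cardinality is read as $\infty$. The minimum over an empty family is read as $\infty$. Condition (P). Let $\delta$ be a functor defined on a category $C$ and let $a,b\in \mathrm{ob}(C)$. The functor $\delta$ fulfills (P) at $a,b$ if for each $r\in\mathbb N$ there exists $c\in \mathrm{ob}(C)$ such that for each $r$-coloring $\chi$ of $\hom(a,c)$ there exists $g\in\hom(b,c)$ such that for all $f_1,f_2\in\hom(a,b)$: $\delta(f_1)=\delta(f_2)$ implies $\chi(g\cdot f_1)=\chi(g\cdot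 f_2)$. The functor $\delta$ fulfills (P) if it fulfills (P) at all $a,b\in\mathrm{ob}(C)$. Frank functors. A functor $\delta\colon C\to D$ is frank if for all $a\in\mathrm{ob}(C)$ and $b'\in\mathrm{ob}(D)$ there exists $b\in\mathrm{ob}(C)$ with $\delta(b)=b'$ (equality of objects) and $\delta(\hom(a,b))=\hom(\delta(a),\delta(b))$. Generated semigroup. For a family $\Delta$ of endofunctors of $C$, $\langle\Delta\rangle$ is the semigroup generated by $\Delta$ under composition, that is, the set of all $\delta_1\circ\cdots\circ\delta_n$ with $n\ge1$ and $\delta_1,\dots,\delta_n\in\Delta$. Ramsey degree. For $a,b\in\mathrm{ob}(C)$, $\mathrm{rd}(a,b)$ is the smallest $k\in\mathbb N$, if one exists, such that for each $r\in\mathbb N$ there exists $c\in\mathrm{ob}(C)$ such that for each $r$-coloring $\chi$ of $\hom(a,c)$ there exists $g\in\hom(b,c)$ with $\chi$ attaining at most $k$ values on $g\cdot\hom(a,b)=\{g\cdot f\mid f\in\hom(a,b)\}$; if no such $k$ exists, $\mathrm{rd}(a,b)=\infty$. Further, $\mathrm{rd}(a)=\sup_{b\in\mathrm{ob}(C)}\mathrm{rd}(a,b)$. *)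

theory Defs
  imports Main "HOL-Library.Extended_Nat"
begin

record ('o, 'm) cat =
  Ob :: "'o set"
  Mor :: "'m set"
  Dom :: "'m \<Rightarrow> 'o"
  Cod :: "'m \<Rightarrow> 'o"
  Id :: "'o \<Rightarrow> 'm"
  Comp :: "'m \<Rightarrow> 'm \<Rightarrow> 'm"

definition hom :: "('o, 'm) cat \<Rightarrow> 'o \<Rightarrow> 'o \<Rightarrow> 'm set" where
  "hom C a b = {f \<in> Mor C. Dom C f = a \<and> Cod C f = b}"

(* Comp C g f is the composite g . f, i.e. f is applied first. *)
locale category =
  fixes C :: "('o, 'm) cat"
  assumes Dom_Ob: "f \<in> Mor C \<Longrightarrow> Dom C f \<in> Ob C"
    and Cod_Ob: "f \<in> Mor C \<Longrightarrow> Cod C f \<in> Ob C"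
    and Id_hom: "a \<in> Ob C \<Longrightarrow> Id C a \<in> hom C a a"
    and Comp_hom: "\<lbrakk>f \<in> hom C a b; g \<in> hom C b c\<rbrakk> \<Longrightarrow> Comp C g f \<in> hom C a c"
    and Comp_Id_right: "f \<in> hom C a b \<Longrightarrow> Comp C f (Id C a) = f"
    and Comp_Id_left: "f \<in> hom C a b \<Longrightarrow> Comp C (Id C b) f = f"
    and Comp_assoc: "\<lbrakk>f \<in> hom C a b; g \<in> hom C b c; h \<in> hom C c d\<rbrakk> \<Longrightarrow>
      Comp C h (Comp C g f) = Comp C (Comp C h g) f"

record ('o1, 'm1, 'o2, 'm2) fun_data =
  obj_map :: "'o1 \<Rightarrow> 'o2"
  mor_map :: "'m1 \<Rightarrow> 'm2"

locale cat_functor = C: category C + D: category D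
  for C :: "('o1, 'm1) cat" and D :: "('o2, 'm2) cat" +
  fixes F :: "('o1, 'm1, 'o2, 'm2) fun_data"
  assumes obj_map_Ob: "a \<in> Ob C \<Longrightarrow> obj_map F a \<in> Ob D"
    and mor_map_hom: "f \<in> hom C a b \<Longrightarrow> mor_map F f \<in> hom D (obj_map F a) (obj_map F b)"
    and mor_map_Id: "a \<in> Ob C \<Longrightarrow> mor_map F (Id C a) = Id D (obj_map F a)"
    and mor_map_Comp: "\<lbrakk>f \<in> hom C a b; g \<in> hom C b c\<rbrakk> \<Longrightarrow>
      mor_map F (Comp C g f) = Comp D (mor_map F g) (mor_map F f)"

definition fun_comp ::
  "('o2, 'm2, 'o3, 'm3) fun_data \<Rightarrow> ('o1, 'm1, 'o2, 'm2) fun_data \<Rightarrow> ('o1, 'm1, 'o3, 'm3) fun_data"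
  where "fun_comp G F = \<lparr>obj_map = obj_map G \<circ> obj_map F, mor_map = mor_map G \<circ> mor_map F\<rparr>"

inductive_set generated_semigroup ::
  "('o, 'm, 'o, 'm) fun_data set \<Rightarrow> ('o, 'm, 'o, 'm) fun_data set"
  for \<Delta> :: "('o, 'm, 'o, 'm) fun_data set"
where
  generator: "\<delta> \<in> \<Delta> \<Longrightarrow> \<delta> \<in> generated_semigroup \<Delta>"
| composite: "\<lbrakk>\<delta> \<in> generated_semigroup \<Delta>; \<epsilon> \<in> generated_semigroup \<Delta>\<rbrakk> \<Longrightarrow>
    fun_comp \<delta> \<epsilon> \<in> generated_semigroup \<Delta>"

definition at_most_values :: "('m \<Rightarrow> 'c) \<Rightarrow> 'm set \<Rightarrow> nat \<Rightarrow> bool" where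
  "at_most_values \<chi> X k \<longleftrightarrow> finite (\<chi> ` X) \<and> card (\<chi> ` X) \<le> k"

(* Colors are natural numbers; since a coloring has only finitely many values, this
   amounts to naming the colors and loses no colorings. Only the restriction of \<chi> to X matters. *)
definition coloring :: "nat \<Rightarrow> 'm set \<Rightarrow> ('m \<Rightarrow> nat) \<Rightarrow> bool" where
  "coloring r X \<chi> \<longleftrightarrow> at_most_values \<chi> X r"

definition fulfills_P_at ::
  "('o, 'm) cat \<Rightarrow> ('o, 'm, 'o2, 'm2) fun_data \<Rightarrow> 'o \<Rightarrow> 'o \<Rightarrow> bool" where
  "fulfills_P_at C \<delta> a b \<longleftrightarrow>
    (\<forall>r::nat. \<exists>c\<in>Ob C. \<forall>\<chi>. coloring r (hom C a c) \<chi> \<longrightarrow>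
      (\<exists>g\<in>hom C b c. \<forall>f1\<in>hom C a b. \<forall>f2\<in>hom C a b.
        mor_map \<delta> f1 = mor_map \<delta> f2 \<longrightarrow> \<chi> (Comp C g f1) = \<chi> (Comp C g f2)))"

definition fulfills_P :: "('o, 'm) cat \<Rightarrow> ('o, 'm, 'o2, 'm2) fun_data \<Rightarrow> bool" where
  "fulfills_P C \<delta> \<longleftrightarrow> (\<forall>a\<in>Ob C. \<forall>b\<in>Ob C. fulfills_P_at C \<delta> a b)"

definition frank ::
  "('o1, 'm1) cat \<Rightarrow> ('o2, 'm2) cat \<Rightarrow> ('o1, 'm1, 'o2, 'm2) fun_data \<Rightarrow> bool" where
  "frank C D \<delta> \<longleftrightarrow>
    (\<forall>a\<in>Ob C. \<forall>b'\<in>Ob D. \<exists>b\<in>Ob C. obj_map \<delta> b = b' \<and>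
      mor_map \<delta> ` hom C a b = hom D (obj_map \<delta> a) (obj_map \<delta> b))"

definition ramsey_bound :: "('o, 'm) cat \<Rightarrow> 'o \<Rightarrow> 'o \<Rightarrow> nat \<Rightarrow> bool" where
  "ramsey_bound C a b k \<longleftrightarrow>
    (\<forall>r::nat. \<exists>c\<in>Ob C. \<forall>\<chi>. coloring r (hom C a c) \<chi> \<longrightarrow>
      (\<exists>g\<in>hom C b c. at_most_values \<chi> (Comp C g ` hom C a b) k))"

definition rd :: "('o, 'm) cat \<Rightarrow> 'o \<Rightarrow> 'o \<Rightarrow> enat" where
  "rd C a b = (if \<exists>k. ramsey_bound C a b k then enat (LEAST k. ramsey_bound C a b k) else \<infinity>)"

definition rd_obj :: "('o, 'm) cat \<Rightarrow> 'o \<Rightarrow> enat" where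
  "rd_obj C a = (SUP b\<in>Ob C. rd C a b)"

definition ecard :: "'a set \<Rightarrow> enat" where
  "ecard X = (if finite X then enat (card X) else \<infinity>)"

(* On enat, the infimum of a nonempty set is its least element and Inf {} = \<infinity>,
   so INF is the minimum with the convention for the empty family. *)
definition min_image_card ::
  "('o, 'm) cat \<Rightarrow> ('o, 'm, 'o, 'm) fun_data set \<Rightarrow> 'o \<Rightarrow> 'o \<Rightarrow> enat" where
  "min_image_card C \<Delta> a b =
    (INF \<delta>\<in>generated_semigroup \<Delta>. ecard (mor_map \<delta> ` hom C a b))"

end

theory Submission
  imports Defs
begin

text \<open>
  If \<open>\<delta>\<close> fulfills (P) at \<open>a, b\<close>, a suitable \<open>g\<close> makes the coloring \<open>f \<mapsto> \<chi> (g \<cdot> f)\<close> of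
  \<open>hom(a, b)\<close> factor through \<open>\<delta>\<close>, so that at most \<open>|\<delta>(hom(a, b))|\<close> colors survive. It thus
  suffices that frank functors fulfilling (P) are closed under composition. For (P), stabilize
  a coloring with respect to \<open>\<delta>\<close>, push it down along \<open>\<delta>\<close>, stabilize it there with respect
  to \<open>\<gamma>\<close>, and lift the morphism so obtained back along \<open>\<delta>\<close>; frankness makes it liftable.
\<close>

lemma cat_functor_fun_comp:
  assumes "cat_functor B C F" "cat_functor C D G"
  shows "cat_functor B D (fun_comp G F)"
proof -
  interpret F: cat_functor B C F by fact
  interpret G: cat_functor C D G by fact
  show ?thesis
  proof unfold_locales
    fix a assume "a \<in> Ob B"
    then show "obj_map (fun_comp G F) a \<in> Ob D"
      and "mor_map (fun_comp G F) (Id B a) = Id D (obj_map (fun_comp G F) a)"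
      by (simp_all add: fun_comp_def F.obj_map_Ob G.obj_map_Ob F.mor_map_Id G.mor_map_Id)
  next
    fix f a b assume f: "f \<in> hom B a b"
    show "mor_map (fun_comp G F) f \<in> hom D (obj_map (fun_comp G F) a) (obj_map (fun_comp G F) b)"
      using G.mor_map_hom[OF F.mor_map_hom[OF f]] by (simp add: fun_comp_def)
    fix g c assume g: "g \<in> hom B b c"
    show "mor_map (fun_comp G F) (Comp B g f)
        = Comp D (mor_map (fun_comp G F) g) (mor_map (fun_comp G F) f)"
      using F.mor_map_Comp[OF f g] G.mor_map_Comp[OF F.mor_map_hom[OF f] F.mor_map_hom[OF g]]
      by (simp add: fun_comp_def)
  qed
qed

text \<open>An object \<open>d\<close> is lifted in two stages: frankness of \<open>G\<close> at
  \<open>obj_map F a\<close> gives \<open>c\<close> over \<open>d\<close>, then frankness of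
  \<open>F\<close> at \<open>a\<close> gives \<open>b\<close> over \<open>c\<close>. Since
  \<open>F\<close> maps \<open>hom B a b\<close> onto the full hom-set into \<open>c\<close>, the
  two surjections compose.\<close>

lemma frank_fun_comp:
  assumes F: "cat_functor B C F" and "frank B C F" "frank C D G"
  shows "frank B D (fun_comp G F)"
  unfolding frank_def
proof (intro ballI)
  fix a d assume a: "a \<in> Ob B" and d: "d \<in> Ob D"
  have "obj_map F a \<in> Ob C" by (rule cat_functor.obj_map_Ob[OF F a])
  then obtain c where c: "c \<in> Ob C" "obj_map G c = d"
    "mor_map G ` hom C (obj_map F a) c = hom D (obj_map G (obj_map F a)) (obj_map G c)"
    using \<open>frank C D G\<close> d unfolding frank_def by blast
  obtain b where b: "b \<in> Ob B" "obj_map F b = c"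
    "mor_map F ` hom B a b = hom C (obj_map F a) (obj_map F b)"
    using \<open>frank B C F\<close> a c(1) unfolding frank_def by blast
  have "mor_map (fun_comp G F) ` hom B a b = mor_map G ` mor_map F ` hom B a b"
    by (simp add: fun_comp_def image_comp)
  with b c show "\<exists>b\<in>Ob B. obj_map (fun_comp G F) b = d \<and>
      mor_map (fun_comp G F) ` hom B a b
        = hom D (obj_map (fun_comp G F) a) (obj_map (fun_comp G F) b)"
    by (intro bexI[of _ b]) (simp_all add: fun_comp_def)
qed

lemma fulfills_P_fun_comp:
  assumes F: "cat_functor B C F" and "frank B C F" "fulfills_P B F" "fulfills_P C G"
  shows "fulfills_P B (fun_comp G F)"
  unfolding fulfills_P_def fulfills_P_at_def
proof (intro ballI allI)
  interpret F: cat_functor B C F by (rule F)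
  fix a b and r :: nat
  assume a: "a \<in> Ob B" and b: "b \<in> Ob B"
  have P_G: "fulfills_P_at C G (obj_map F a) (obj_map F b)"
    using \<open>fulfills_P C G\<close> F.obj_map_Ob[OF a] F.obj_map_Ob[OF b]
    unfolding fulfills_P_def by blast
  \<comment> \<open>one extra color, for the morphisms that do not lift along \<open>F\<close>\<close>
  obtain c' where c': "c' \<in> Ob C"
    and stable_G: "\<forall>\<chi>. coloring (Suc r) (hom C (obj_map F a) c') \<chi> \<longrightarrow>
      (\<exists>g\<in>hom C (obj_map F b) c'.
        \<forall>f1\<in>hom C (obj_map F a) (obj_map F b). \<forall>f2\<in>hom C (obj_map F a) (obj_map F b).
          mor_map G f1 = mor_map G f2 \<longrightarrow> \<chi> (Comp C g f1) = \<chi> (Comp C g f2))"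
    using P_G[unfolded fulfills_P_at_def, rule_format, of "Suc r"] by (elim bexE) (rule that)
  \<comment> \<open>Frankness is applied at \<open>b\<close>, the source of the morphism that will
    have to be lifted.\<close>
  obtain c where c: "c \<in> Ob B" and lift: "mor_map F ` hom B b c = hom C (obj_map F b) c'"
    using \<open>frank B C F\<close> b c' unfolding frank_def by metis
  \<comment> \<open>The pair is \<open>a, c\<close> and not \<open>a, b\<close>: the coloring to be
    pushed down lives on \<open>hom B a c\<close>.\<close>
  have P_F: "fulfills_P_at B F a c"
    using \<open>fulfills_P B F\<close> a c unfolding fulfills_P_def by blast
  obtain d where d: "d \<in> Ob B"
    and stable_F: "\<forall>\<chi>. coloring r (hom B a d) \<chi> \<longrightarrow>
      (\<exists>h\<in>hom B c d. \<forall>f1\<in>hom B a c. \<forall>f2\<in>hom B a c.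
        mor_map F f1 = mor_map F f2 \<longrightarrow> \<chi> (Comp B h f1) = \<chi> (Comp B h f2))"
    using P_F[unfolded fulfills_P_at_def, rule_format, of r] by (elim bexE) (rule that)
  have "\<exists>k\<in>hom B b d. \<forall>f1\<in>hom B a b. \<forall>f2\<in>hom B a b.
      mor_map (fun_comp G F) f1 = mor_map (fun_comp G F) f2 \<longrightarrow>
        \<chi> (Comp B k f1) = \<chi> (Comp B k f2)"
    if col: "coloring r (hom B a d) \<chi>" for \<chi>
  proof -
    obtain h where h: "h \<in> hom B c d"
      and h_stable: "\<And>f1 f2. \<lbrakk>f1 \<in> hom B a c; f2 \<in> hom B a c; mor_map F f1 = mor_map F f2\<rbrakk> \<Longrightarrow>
        \<chi> (Comp B h f1) = \<chi> (Comp B h f2)"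
      using stable_F col by blast
    \<comment> \<open>The coloring of \<open>hom B a c\<close> induced by \<open>h\<close>, pushed
      down along \<open>F\<close>. By \<open>h_stable\<close> the choice of preimage does not affect
      the color; the default 0 may be a color that \<chi> does not use.\<close>
    define \<chi>' where "\<chi>' f' = (if f' \<in> mor_map F ` hom B a c
      then \<chi> (Comp B h (inv_into (hom B a c) (mor_map F) f')) else 0)" for f'
    have push: "\<chi>' (mor_map F f) = \<chi> (Comp B h f)" if "f \<in> hom B a c" for f
      using that h_stable[OF inv_into_into[OF imageI] that f_inv_into_f[OF imageI], OF that that]
      by (simp add: \<chi>'_def)
    have "\<chi>' f' \<in> insert 0 (\<chi> ` hom B a d)" for f'
    proof (cases "f' \<in> mor_map F ` hom B a c")
      case True
      then obtain f where "f \<in> hom B a c" "f' = mor_map F f" by blast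
      then show ?thesis using push F.C.Comp_hom[OF _ h] by simp
    qed (simp add: \<chi>'_def)
    then have sub: "\<chi>' ` X \<subseteq> insert 0 (\<chi> ` hom B a d)" for X
      by (rule image_subsetI)
    have fin: "finite (\<chi> ` hom B a d)" and "card (\<chi> ` hom B a d) \<le> r"
      using col by (auto simp: coloring_def at_most_values_def)
    then have "card (insert 0 (\<chi> ` hom B a d)) \<le> Suc r"
      by (simp add: card_insert_if)
    then have "coloring (Suc r) (hom C (obj_map F a) c') \<chi>'"
      unfolding coloring_def at_most_values_def
      using finite_subset[OF sub] le_trans[OF card_mono[OF _ sub]] fin by simp
    then obtain g' where g': "g' \<in> hom C (obj_map F b) c'"
      and g'_stable: "\<And>f1 f2. \<lbrakk>f1 \<in> hom C (obj_map F a) (obj_map F b);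
          f2 \<in> hom C (obj_map F a) (obj_map F b); mor_map G f1 = mor_map G f2\<rbrakk> \<Longrightarrow>
        \<chi>' (Comp C g' f1) = \<chi>' (Comp C g' f2)"
      using stable_G by blast
    from g' obtain g where g: "g \<in> hom B b c" "mor_map F g = g'"
      unfolding lift[symmetric] by blast
    \<comment> \<open>The witness is \<open>Comp B h g\<close>. As \<open>F\<close> sends the
      composite of \<open>g\<close> and \<open>f\<close> to that of \<open>g'\<close> and
      \<open>mor_map F f\<close>, its coloring of \<open>hom B a b\<close> is read off from \<chi>'
      below.\<close>
    have "\<chi> (Comp B (Comp B h g) f) = \<chi>' (Comp C g' (mor_map F f))" if "f \<in> hom B a b" for f
      using push[OF F.C.Comp_hom[OF that g(1)]] F.mor_map_Comp[OF that g(1)]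
        F.C.Comp_assoc[OF that g(1) h] g(2) by simp
    then have "\<chi> (Comp B (Comp B h g) f1) = \<chi> (Comp B (Comp B h g) f2)"
      if "f1 \<in> hom B a b" "f2 \<in> hom B a b"
        "mor_map (fun_comp G F) f1 = mor_map (fun_comp G F) f2" for f1 f2
      using that g'_stable[OF F.mor_map_hom[OF that(1)] F.mor_map_hom[OF that(2)]]
      by (simp add: fun_comp_def)
    with F.C.Comp_hom[OF g(1) h] show ?thesis by blast
  qed
  with d show "\<exists>d\<in>Ob B. \<forall>\<chi>. coloring r (hom B a d) \<chi> \<longrightarrow>
      (\<exists>k\<in>hom B b d. \<forall>f1\<in>hom B a b. \<forall>f2\<in>hom B a b.
        mor_map (fun_comp G F) f1 = mor_map (fun_comp G F) f2 \<longrightarrow>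
          \<chi> (Comp B k f1) = \<chi> (Comp B k f2))"
    by blast
qed

lemma ramsey_bound_if_fulfills_P_at:
  assumes P: "fulfills_P_at C \<delta> a b" and fin: "finite (mor_map \<delta> ` hom C a b)"
  shows "ramsey_bound C a b (card (mor_map \<delta> ` hom C a b))"
proof -
  have "at_most_values \<chi> (Comp C g ` hom C a b) (card (mor_map \<delta> ` hom C a b))"
    if stable: "\<forall>f1\<in>hom C a b. \<forall>f2\<in>hom C a b.
      mor_map \<delta> f1 = mor_map \<delta> f2 \<longrightarrow> \<chi> (Comp C g f1) = \<chi> (Comp C g f2)"
    for \<chi> :: "'b \<Rightarrow> nat" and g
  proof -
    \<comment> \<open>The map on \<delta>-images through which the coloring factors.\<close>
    let ?\<psi> = "\<lambda>y. \<chi> (Comp C g (inv_into (hom C a b) (mor_map \<delta>) y))"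
    have "\<chi> (Comp C g f) = ?\<psi> (mor_map \<delta> f)" if "f \<in> hom C a b" for f
      using stable that by (metis f_inv_into_f imageI inv_into_into)
    then have "\<chi> ` Comp C g ` hom C a b = ?\<psi> ` mor_map \<delta> ` hom C a b"
      unfolding image_image by (rule image_cong[OF refl])
    then show ?thesis
      unfolding at_most_values_def using fin card_image_le[OF fin, of ?\<psi>] by simp
  qed
  with P show ?thesis
    unfolding ramsey_bound_def fulfills_P_at_def by meson
qed

lemma rd_le_if_fulfills_P_at:
  assumes "fulfills_P_at C \<delta> a b"
  shows "rd C a b \<le> ecard (mor_map \<delta> ` hom C a b)"
\<comment> \<open>For an infinite image the bound is \<infinity>.\<close>
proof (cases "finite (mor_map \<delta> ` hom C a b)")
  case True
  from ramsey_bound_if_fulfills_P_at[OF assms True] show ?thesis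
    using True by (auto simp: rd_def ecard_def intro: Least_le)
qed (simp add: ecard_def)

theorem corollary7:
  fixes C :: "('o, 'm) cat" and \<Delta> :: "('o, 'm, 'o, 'm) fun_data set"
  assumes "category C"
    and "\<And>\<delta>. \<delta> \<in> \<Delta> \<Longrightarrow> cat_functor C C \<delta>"
    and "\<And>\<delta>. \<delta> \<in> \<Delta> \<Longrightarrow> frank C C \<delta>"
    and "\<And>\<delta>. \<delta> \<in> \<Delta> \<Longrightarrow> fulfills_P C \<delta>"
  shows "(\<forall>a\<in>Ob C. \<forall>b\<in>Ob C. rd C a b \<le> min_image_card C \<Delta> a b) \<and>
         (\<forall>a\<in>Ob C. rd_obj C a \<le> (SUP b\<in>Ob C. min_image_card C \<Delta> a b))"
proof -
  \<comment> \<open>The three properties go through the induction together: (P) for a composite also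
    uses functoriality and frankness of the inner factor.\<close>
  have "cat_functor C C \<delta> \<and> frank C C \<delta> \<and> fulfills_P C \<delta>"
    if "\<delta> \<in> generated_semigroup \<Delta>" for \<delta>
    using that
  proof induction
    case (generator \<delta>)
    with assms(2-4) show ?case by blast
  next
    case (composite \<delta> \<epsilon>)
    then show ?case
      by (blast intro: cat_functor_fun_comp frank_fun_comp fulfills_P_fun_comp)
  qed
  then have "rd C a b \<le> min_image_card C \<Delta> a b" if "a \<in> Ob C" "b \<in> Ob C" for a b
    using that unfolding min_image_card_def fulfills_P_def
    by (blast intro: INF_greatest rd_le_if_fulfills_P_at)
  then show ?thesis
    unfolding rd_obj_def by (blast intro: SUP_mono)
qed

end
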